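(* Let $\{\phi_j(x)\}_{j\ge 0}$ be real polynomials with $\deg\phi_j=j$, $\phi_0(x)\equiv 1$, $\phi_{-1}(x)\equiv 0$, satisfying the three-term recurrence $$x\phi_j(x)=\alpha_j\phi_{j+1}(x)+\beta_j\phi_j(x)+\gamma_j\phi_{j-1}(x),\qquad j=0,1,2,\ldots,$$ where $\alpha_j,\beta_j,\gamma_j$ are real and $\alpha_j\neq 0$. Let $n\ge 1$ and let $\mathbf{D}$ be the $(n+1)\times(n+1)$ differentiation matrix, for polynomials of degree at most $n$, in the basis $\{\phi_0,\ldots,\phi_n\}$. Then $$\mathbf{D}=\begin{bmatrix}\mathbf{0}_{1\times n} & 0\\ \mathbf{Q} & \mathbf{0}_{n\times 1}\end{bmatrix}^{T},$$ where $\mathbf{Q}=[\mathbf{Q}_{i,j}]_{1\le i,j\le n}$ is the $n\times n$ lower triangular matrix (so $\mathbf{Q}_{i,j}=0$ for $i<j$) given by $$\mathbf{Q}_{i,j}=\begin{cases}\dfrac{i}{\alpha_{i-1}}, & i=j,\\[2mm] \dfrac{1}{\alpha_{i-1}}\Big((\beta_{j-1}-\beta_{i-1})\mathbf{Q}_{i-1,j}+\alpha_{j-2}\mathbf{Q}_{i-1,j-1}+\gamma_j\mathbf{Q}_{i-1,j+1}-\gamma_{i-1}\mathbf{Q}_{i-2,j}\Big), & i>j,\end{cases}$$ where any term containing an entry of $\mathbf{Q}$ with a zero or negative index is omitted (taken to be $0$).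
   Context: For a basis $\boldsymbol\phi=[\phi_0,\ldots,\phi_n]$ of the space of polynomials of degree at most $n$, the differentiation matrix $\mathbf{D}$ in this basis is the $(n+1)\times(n+1)$ matrix (rows and columns indexed from $0$ to $n$) such that if $f=\sum_{k=0}^n a_k\phi_k$ and $f'=\sum_{k=0}^n b_k\phi_k$ then $\mathbf{b}=\mathbf{D}\mathbf{a}$, for the column vectors $\mathbf{a}=[a_0,\ldots,a_n]^T$, $\mathbf{b}=[b_0,\ldots,b_n]^T$. Equivalently, the $k$-th column of $\mathbf{D}$ consists of the coefficients of $\phi_k'$ in the basis $\{\phi_j\}$. *)

theory Defs
  imports
    "HOL-Computational_Algebra.Polynomial"
    "Jordan_Normal_Form.Matrix"
begin

text \<open>Intended for a basis \<open>\<phi> 0, \<dots>, \<phi> n\<close> of the polynomials of degree at most \<open>n\<close>;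
  there exactly one matrix satisfies the predicate.\<close>

definition is_differentiation_matrix ::
    "(nat \<Rightarrow> real poly) \<Rightarrow> nat \<Rightarrow> real mat \<Rightarrow> bool" where
  "is_differentiation_matrix \<phi> n D \<longleftrightarrow>
     D \<in> carrier_mat (n + 1) (n + 1) \<and>
     (\<forall>f a b.
        a \<in> carrier_vec (n + 1) \<longrightarrow> b \<in> carrier_vec (n + 1) \<longrightarrow>
        f = (\<Sum>k\<le>n. Polynomial.smult (a $ k) (\<phi> k)) \<longrightarrow>
        pderiv f = (\<Sum>k\<le>n. Polynomial.smult (b $ k) (\<phi> k)) \<longrightarrow>
        b = D *\<^sub>v a)"

text \<open>The \<open>case\<close> expression is \<open>\<phi>\<close> at \<open>j - 1\<close>, with the convention that \<open>\<phi>\<close> at \<open>-1\<close> is \<open>0\<close>.\<close>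

definition three_term_recurrence ::
    "(nat \<Rightarrow> real poly) \<Rightarrow> (nat \<Rightarrow> real) \<Rightarrow> (nat \<Rightarrow> real) \<Rightarrow> (nat \<Rightarrow> real) \<Rightarrow> bool" where
  "three_term_recurrence \<phi> \<alpha> \<beta> \<gamma> \<longleftrightarrow>
     (\<forall>j. [:0, 1:] * \<phi> j =
        Polynomial.smult (\<alpha> j) (\<phi> (j + 1)) + Polynomial.smult (\<beta> j) (\<phi> j)
        + Polynomial.smult (\<gamma> j) (case j of 0 \<Rightarrow> 0 | Suc i \<Rightarrow> \<phi> i))"

text \<open>Entries are indexed from 1; those with index \<open>0\<close> are \<open>0\<close>. Truncated subtraction is harmless:
  the last branch has \<open>i \<ge> 2\<close>, and for \<open>j = 1\<close> the factor \<open>\<alpha> (j - 2)\<close> multiplies an entry with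
  column index \<open>0\<close>.\<close>

fun Q_entry ::
    "(nat \<Rightarrow> real) \<Rightarrow> (nat \<Rightarrow> real) \<Rightarrow> (nat \<Rightarrow> real) \<Rightarrow> nat \<Rightarrow> nat \<Rightarrow> real" where
  "Q_entry \<alpha> \<beta> \<gamma> i j =
     (if i = 0 \<or> j = 0 \<or> i < j then 0
      else if i = j then real i / \<alpha> (i - 1)
      else 1 / \<alpha> (i - 1) *
        ((\<beta> (j - 1) - \<beta> (i - 1)) * Q_entry \<alpha> \<beta> \<gamma> (i - 1) j
         + \<alpha> (j - 2) * Q_entry \<alpha> \<beta> \<gamma> (i - 1) (j - 1)
         + \<gamma> j * Q_entry \<alpha> \<beta> \<gamma> (i - 1) (j + 1)
         - \<gamma> (i - 1) * Q_entry \<alpha> \<beta> \<gamma> (i - 2) j))"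

declare Q_entry.simps [simp del]

definition Q_mat ::
    "(nat \<Rightarrow> real) \<Rightarrow> (nat \<Rightarrow> real) \<Rightarrow> (nat \<Rightarrow> real) \<Rightarrow> nat \<Rightarrow> real mat" where
  "Q_mat \<alpha> \<beta> \<gamma> n = mat n n (\<lambda>(i, j). Q_entry \<alpha> \<beta> \<gamma> (i + 1) (j + 1))"

end

(* Differentiating the recurrence for j = i - 1 gives
     alpha_{i-1} phi_i' = phi_{i-1} + (x - beta_{i-1}) phi_{i-1}' - gamma_{i-1} phi_{i-2}'.
   Expanding phi_{i-1}' and phi_{i-2}' in the basis and applying the recurrence once more to
   x phi_l, a comparison of coefficients is exactly the recursion for Q, so by induction row i
   of Q holds the coordinates of phi_i'. Linear independence gives uniqueness of D. *)

theory Submission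
  imports Defs
begin

hide_const (open) Module.smult

lemma smult_sum_right: "smult a (\<Sum>i\<in>A. p i) = (\<Sum>i\<in>A. smult a (p i))"
  by (induction A rule: infinite_finite_induct) (simp_all add: smult_add_right)

text \<open>Only the last term reaches degree \<open>Suc n\<close>, so its coefficient must vanish,
  and induction handles the shorter sum. Nonvanishing of \<open>\<phi> 0\<close> is a separate
  assumption because the zero polynomial also has \<open>degree\<close> 0; in higher degrees it
  follows from \<open>deg\<close>.\<close>

lemma sum_smult_degree_eq_0:
  fixes \<phi> :: "nat \<Rightarrow> 'a::idom poly"
  assumes deg: "\<And>j. degree (\<phi> j) = j" and "\<phi> 0 \<noteq> 0"
    and "(\<Sum>k\<le>n. smult (c k) (\<phi> k)) = 0" and "k \<le> n"
  shows "c k = 0"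
  using assms(3,4)
proof (induction n arbitrary: k)
  case 0
  then show ?case using assms(2) by simp
next
  case (Suc n)
  have "coeff (\<phi> k) (Suc n) = 0" if "k \<le> n" for k
    using that by (intro coeff_eq_0) (simp add: deg)
  then have "coeff (\<Sum>k\<le>Suc n. smult (c k) (\<phi> k)) (Suc n) = c (Suc n) * coeff (\<phi> (Suc n)) (Suc n)"
    by (simp add: coeff_sum)
  moreover have "coeff (\<phi> (Suc n)) (Suc n) \<noteq> 0"
    using deg[of "Suc n"] by (metis degree_0 leading_coeff_0_iff nat.distinct(1))
  ultimately have top: "c (Suc n) = 0"
    by (metis Suc.prems(1) coeff_0 mult_eq_0_iff)
  then have "(\<Sum>k\<le>n. smult (c k) (\<phi> k)) = 0"
    using Suc.prems(1) by simp
  then show ?case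
    using Suc.IH Suc.prems(2) top by (cases "k = Suc n") auto
qed

lemma sum_smult_degree_eq_iff:
  fixes \<phi> :: "nat \<Rightarrow> 'a::idom poly"
  assumes "\<And>j. degree (\<phi> j) = j" and "\<phi> 0 \<noteq> 0"
  shows "(\<Sum>k\<le>n. smult (a k) (\<phi> k)) = (\<Sum>k\<le>n. smult (b k) (\<phi> k)) \<longleftrightarrow> (\<forall>k\<le>n. a k = b k)"
proof
  assume "(\<Sum>k\<le>n. smult (a k) (\<phi> k)) = (\<Sum>k\<le>n. smult (b k) (\<phi> k))"
  then have "(\<Sum>k\<le>n. smult (a k - b k) (\<phi> k)) = 0"
    by (simp add: smult_diff_left sum_subtractf)
  then show "\<forall>k\<le>n. a k = b k"
    using sum_smult_degree_eq_0[where c = "\<lambda>k. a k - b k", OF assms] by fastforce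
qed simp

text \<open>Coordinates are shifted by one: \<open>c (l + 1)\<close> is the coefficient of \<open>\<phi> l\<close>,
  as in a row of \<open>Q\<close>.\<close>

lemma three_term_recurrence_X_mult_sum:
  assumes rec: "three_term_recurrence \<phi> \<alpha> \<beta> \<gamma>"
    and c0: "c 0 = 0" and c_hi: "\<And>j. j > m \<Longrightarrow> c j = 0"
  shows "[:0, 1:] * (\<Sum>l\<le>m. smult (c (l + 1)) (\<phi> l)) =
    (\<Sum>l\<le>m. smult (\<alpha> (l - 1) * c l + \<beta> l * c (l + 1) + \<gamma> (l + 1) * c (l + 2)) (\<phi> l))"
proof -
  let ?prev = "\<lambda>j. case j of 0 \<Rightarrow> 0 | Suc i \<Rightarrow> \<phi> i"
  \<comment> \<open>Index shift by one: the new top term carries \<open>c (m + 1) = 0\<close>, so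
    multiplication by x does not leave the range, and the bottom term carries
    \<open>c 0 = 0\<close>, which makes the value of \<open>l - 1\<close> at \<open>l = 0\<close>
    irrelevant.\<close>
  have up: "(\<Sum>l\<le>m. smult (c (l + 1) * \<alpha> l) (\<phi> (l + 1))) = (\<Sum>l\<le>m. smult (\<alpha> (l - 1) * c l) (\<phi> l))"
  proof -
    have "(\<Sum>l\<le>m. smult (\<alpha> (l - 1) * c l) (\<phi> l)) = (\<Sum>l\<le>Suc m. smult (\<alpha> (l - 1) * c l) (\<phi> l))"
      by (simp add: c_hi)
    then show ?thesis
      by (simp only: sum.atMost_Suc_shift) (simp add: c0 mult.commute)
  qed
  \<comment> \<open>The opposite shift: the added top term carries \<open>c (m + 2) = 0\<close>, and
    the bottom term vanishes because \<open>?prev 0\<close> is 0.\<close>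
  have down: "(\<Sum>l\<le>m. smult (c (l + 1) * \<gamma> l) (?prev l)) = (\<Sum>l\<le>m. smult (\<gamma> (l + 1) * c (l + 2)) (\<phi> l))"
  proof -
    have "(\<Sum>l\<le>m. smult (c (l + 1) * \<gamma> l) (?prev l)) = (\<Sum>l\<le>Suc m. smult (c (l + 1) * \<gamma> l) (?prev l))"
      by (simp add: c_hi)
    then show ?thesis
      by (simp only: sum.atMost_Suc_shift) (simp add: mult.commute)
  qed
  have "[:0, 1:] * (\<Sum>l\<le>m. smult (c (l + 1)) (\<phi> l)) = (\<Sum>l\<le>m. smult (c (l + 1)) ([:0, 1:] * \<phi> l))"
    by (simp only: sum_distrib_left mult_smult_right)
  also have "\<dots> = (\<Sum>l\<le>m. smult (c (l + 1)) (smult (\<alpha> l) (\<phi> (l + 1)) + smult (\<beta> l) (\<phi> l) + smult (\<gamma> l) (?prev l)))"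
    using rec unfolding three_term_recurrence_def by simp
  also have "\<dots> = (\<Sum>l\<le>m. smult (c (l + 1) * \<alpha> l) (\<phi> (l + 1))) + (\<Sum>l\<le>m. smult (\<beta> l * c (l + 1)) (\<phi> l))
      + (\<Sum>l\<le>m. smult (c (l + 1) * \<gamma> l) (?prev l))"
    by (simp only: smult_add_right smult_smult sum.distrib mult.commute[of "\<beta> _"])
  also have "\<dots> = (\<Sum>l\<le>m. smult (\<alpha> (l - 1) * c l) (\<phi> l)) + (\<Sum>l\<le>m. smult (\<beta> l * c (l + 1)) (\<phi> l))
      + (\<Sum>l\<le>m. smult (\<gamma> (l + 1) * c (l + 2)) (\<phi> l))"
    by (simp only: up down)
  finally show ?thesis
    by (simp only: smult_add_left sum.distrib)
qed

lemma Q_entry_eq_0: "i = 0 \<or> j = 0 \<or> i < j \<Longrightarrow> Q_entry \<alpha> \<beta> \<gamma> i j = 0"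
  by (subst Q_entry.simps) simp

lemma Q_entry_diag: "Q_entry \<alpha> \<beta> \<gamma> i i = real i / \<alpha> (i - 1)"
  by (subst Q_entry.simps) simp

text \<open>One formula for all columns, so that coefficients can be compared without cases. Below
  the diagonal it is the definition; on it, it reads \<open>i + 1 = 1 + i\<close>, the 1 being
  \<open>of_bool\<close>; above it, every term is 0. The \<open>of_bool\<close> summand is the
  coordinate of the extra \<phi>_i that the product rule yields from x \<phi>_i.\<close>

lemma Q_entry_Suc_rec:
  assumes nz: "\<And>j. \<alpha> j \<noteq> 0"
  shows "\<alpha> i * Q_entry \<alpha> \<beta> \<gamma> (Suc i) (l + 1) =
    of_bool (l = i) + (\<beta> l - \<beta> i) * Q_entry \<alpha> \<beta> \<gamma> i (l + 1)
    + \<alpha> (l - 1) * Q_entry \<alpha> \<beta> \<gamma> i l + \<gamma> (l + 1) * Q_entry \<alpha> \<beta> \<gamma> i (l + 2)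
    - \<gamma> i * Q_entry \<alpha> \<beta> \<gamma> (i - 1) (l + 1)"
proof (cases l i rule: linorder_cases)
  case less
  then show ?thesis
    using nz[of i] by (subst Q_entry.simps) (simp add: algebra_simps)
next
  case equal
  then show ?thesis
    using nz by (cases i) (simp_all add: Q_entry_eq_0 Q_entry_diag)
next
  case greater
  then have "i - 1 < l + 1"
    by simp
  then show ?thesis
    using greater by (simp add: Q_entry_eq_0 del: One_nat_def)
qed

text \<open>The bound \<open>m\<close> is kept fixed above \<open>i\<close>, so that all expansions
  in the induction step run over the same range.\<close>

lemma pderiv_eq_sum_Q_entry:
  fixes \<phi> :: "nat \<Rightarrow> real poly"
  assumes one: "\<phi> 0 = 1" and nz: "\<And>j. \<alpha> j \<noteq> 0" and rec: "three_term_recurrence \<phi> \<alpha> \<beta> \<gamma>"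
  shows "i \<le> m \<Longrightarrow> pderiv (\<phi> i) = (\<Sum>l\<le>m. smult (Q_entry \<alpha> \<beta> \<gamma> i (l + 1)) (\<phi> l))"
proof (induction i rule: less_induct)
  case (less i)
  let ?Q = "Q_entry \<alpha> \<beta> \<gamma>"
  let ?S = "\<lambda>c. \<Sum>l\<le>m. smult (c l) (\<phi> l)"
  show ?case
  proof (cases i)
    case 0
    then show ?thesis by (simp add: one Q_entry_eq_0)
  next
    case (Suc k)
    let ?prev = "case k of 0 \<Rightarrow> 0 | Suc j \<Rightarrow> \<phi> j"
    have k: "pderiv (\<phi> k) = ?S (\<lambda>l. ?Q k (l + 1))"
      using less Suc by simp
    \<comment> \<open>For \<open>k = 0\<close> truncation turns \<open>k - 1\<close> into 0, and row
      0 of Q is zero, in agreement with \<phi>_{-1} = 0.\<close>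
    have prev: "pderiv ?prev = ?S (\<lambda>l. ?Q (k - 1) (l + 1))"
      using less Suc by (cases k) (simp_all add: Q_entry_eq_0)
    have phi_k: "\<phi> k = ?S (\<lambda>l. of_bool (l = k))"
    proof -
      have "?S (\<lambda>l. of_bool (l = k)) = (\<Sum>l\<le>m. if l = k then \<phi> k else 0)"
        by (rule sum.cong) auto
      then show ?thesis using less.prems Suc by simp
    qed
    \<comment> \<open>Row \<open>k\<close> of Q vanishes beyond column \<open>k\<close>, and
      \<open>k < i \<le> m\<close>, so the shift lemma applies with \<open>c = ?Q k\<close>.\<close>
    have X: "[:0, 1:] * pderiv (\<phi> k) =
        ?S (\<lambda>l. \<alpha> (l - 1) * ?Q k l + \<beta> l * ?Q k (l + 1) + \<gamma> (l + 1) * ?Q k (l + 2))"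
      unfolding k using less.prems Suc
      by (intro three_term_recurrence_X_mult_sum[OF rec, where c = "?Q k"]) (simp_all add: Q_entry_eq_0)
    have "[:0, 1:] * \<phi> k = smult (\<alpha> k) (\<phi> i) + smult (\<beta> k) (\<phi> k) + smult (\<gamma> k) ?prev"
      using rec Suc unfolding three_term_recurrence_def by simp
    then have "pderiv ([:0, 1:] * \<phi> k) = pderiv (smult (\<alpha> k) (\<phi> i) + smult (\<beta> k) (\<phi> k) + smult (\<gamma> k) ?prev)"
      by (rule arg_cong)
    moreover have "pderiv ([:0, 1:] * \<phi> k) = [:0, 1:] * pderiv (\<phi> k) + \<phi> k"
      by (simp add: pderiv_mult pderiv_pCons)
    ultimately have "smult (\<alpha> k) (pderiv (\<phi> i)) =
        \<phi> k + [:0, 1:] * pderiv (\<phi> k) - smult (\<beta> k) (pderiv (\<phi> k)) - smult (\<gamma> k) (pderiv ?prev)"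
      by (simp only: pderiv_add pderiv_smult)
    also have "\<dots> = ?S (\<lambda>l. of_bool (l = k))
        + ?S (\<lambda>l. \<alpha> (l - 1) * ?Q k l + \<beta> l * ?Q k (l + 1) + \<gamma> (l + 1) * ?Q k (l + 2))
        - smult (\<beta> k) (?S (\<lambda>l. ?Q k (l + 1))) - smult (\<gamma> k) (?S (\<lambda>l. ?Q (k - 1) (l + 1)))"
      by (simp only: X prev phi_k[symmetric] k[symmetric])
    also have "\<dots> = ?S (\<lambda>l. of_bool (l = k) + (\<alpha> (l - 1) * ?Q k l + \<beta> l * ?Q k (l + 1) + \<gamma> (l + 1) * ?Q k (l + 2))
        - \<beta> k * ?Q k (l + 1) - \<gamma> k * ?Q (k - 1) (l + 1))"
      by (simp only: smult_sum_right smult_smult smult_add_left smult_diff_left sum.distrib sum_subtractf)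
    also have "\<dots> = ?S (\<lambda>l. \<alpha> k * ?Q i (l + 1))"
      unfolding Suc Q_entry_Suc_rec[where \<alpha> = \<alpha>, OF nz] by (simp only: algebra_simps)
    also have "\<dots> = smult (\<alpha> k) (?S (\<lambda>l. ?Q i (l + 1)))"
      by (simp only: smult_sum_right smult_smult)
    finally have "smult (inverse (\<alpha> k)) (smult (\<alpha> k) (pderiv (\<phi> i))) =
        smult (inverse (\<alpha> k)) (smult (\<alpha> k) (?S (\<lambda>l. ?Q i (l + 1))))"
      by (rule arg_cong)
    then show ?thesis
      by (simp only: smult_smult left_inverse[OF nz] smult_1_left)
  qed
qed

text \<open>The zero border agrees with the zero entries of \<open>Q_entry\<close>: the top row is
  row 0, and the last column is column \<open>n + 1\<close>, which lies above the diagonal.\<close>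

lemma transpose_four_block_Q_mat:
  "transpose_mat (four_block_mat (0\<^sub>m 1 n) (0\<^sub>m 1 1) (Q_mat \<alpha> \<beta> \<gamma> n) (0\<^sub>m n 1)) =
    mat (n + 1) (n + 1) (\<lambda>(l, k). Q_entry \<alpha> \<beta> \<gamma> k (l + 1))"
  by (rule eq_matI) (auto simp: Q_mat_def Q_entry_eq_0)

text \<open>Testing the predicate on unit vectors, that is on \<open>f = \<phi> k\<close>, fixes
  every column of \<open>D\<close>. Conversely, linear independence lets the two expansions of the
  derivative of \<open>f\<close> be compared coefficientwise.\<close>

lemma is_differentiation_matrix_iff:
  fixes \<phi> :: "nat \<Rightarrow> real poly"
  assumes deg: "\<And>j. degree (\<phi> j) = j" and nz: "\<phi> 0 \<noteq> 0"
    and deriv: "\<And>k. k \<le> n \<Longrightarrow> pderiv (\<phi> k) = (\<Sum>l\<le>n. smult (q k l) (\<phi> l))"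
  shows "is_differentiation_matrix \<phi> n D \<longleftrightarrow> D = mat (n + 1) (n + 1) (\<lambda>(l, k). q k l)"
    (is "_ \<longleftrightarrow> D = ?M")
proof
  assume D: "is_differentiation_matrix \<phi> n D"
  then have dim: "D \<in> carrier_mat (n + 1) (n + 1)"
    by (simp add: is_differentiation_matrix_def)
  have col: "vec (n + 1) (q k) = D *\<^sub>v unit_vec (n + 1) k" if "k \<le> n" for k
  proof -
    have "(\<Sum>j\<le>n. smult (unit_vec (n + 1) k $ j) (\<phi> j)) = (\<Sum>j\<le>n. if j = k then \<phi> k else 0)"
      using that by (intro sum.cong) auto
    then have "\<phi> k = (\<Sum>j\<le>n. smult (unit_vec (n + 1) k $ j) (\<phi> j))"
      using that by simp
    moreover have "pderiv (\<phi> k) = (\<Sum>l\<le>n. smult (vec (n + 1) (q k) $ l) (\<phi> l))"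
      using deriv[OF that] by simp
    ultimately show ?thesis
      using D unfolding is_differentiation_matrix_def by (meson unit_vec_carrier vec_carrier)
  qed
  show "D = ?M"
  proof (rule eq_matI)
    fix l k assume "l < dim_row ?M" "k < dim_col ?M"
    then have lk: "l \<le> n" "k \<le> n" by simp_all
    have "D $$ (l, k) = (D *\<^sub>v unit_vec (n + 1) k) $ l"
      using lk dim by simp
    also have "\<dots> = q k l"
      using lk(1) by (subst col[OF lk(2), symmetric]) simp
    finally show "D $$ (l, k) = ?M $$ (l, k)"
      using lk by simp
  qed (use dim in simp_all)
next
  assume D: "D = ?M"
  show "is_differentiation_matrix \<phi> n D"
    unfolding is_differentiation_matrix_def
  proof (intro conjI allI impI)
    show "D \<in> carrier_mat (n + 1) (n + 1)" by (simp add: D)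
    fix f and a b :: "real vec"
    assume a: "a \<in> carrier_vec (n + 1)" and b: "b \<in> carrier_vec (n + 1)"
      and f: "f = (\<Sum>k\<le>n. smult (a $ k) (\<phi> k))" and f': "pderiv f = (\<Sum>k\<le>n. smult (b $ k) (\<phi> k))"
    have "pderiv f = (\<Sum>k\<le>n. \<Sum>l\<le>n. smult (a $ k * q k l) (\<phi> l))"
      \<comment> \<open>The instance of \<open>higher_pderiv_sum\<close> for the first derivative is
        additivity of \<open>pderiv\<close> over finite sums.\<close>
      by (simp add: f higher_pderiv_sum[of 1, simplified] pderiv_smult deriv smult_sum_right)
    also have "\<dots> = (\<Sum>l\<le>n. smult (\<Sum>k\<le>n. a $ k * q k l) (\<phi> l))"
      by (subst sum.swap) (simp add: smult_sum)
    finally have "\<forall>l\<le>n. b $ l = (\<Sum>k\<le>n. a $ k * q k l)"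
      unfolding f' sum_smult_degree_eq_iff[OF deg nz] .
    then show "b = D *\<^sub>v a"
      using a b
      by (intro eq_vecI)
        (auto simp: D scalar_prod_def mult.commute atLeast0LessThan lessThan_Suc_atMost
          less_Suc_eq_le intro!: sum.cong)
  qed
qed

theorem mainTheorem1:
  fixes \<phi> :: "nat \<Rightarrow> real poly" and \<alpha> \<beta> \<gamma> :: "nat \<Rightarrow> real"
    and n :: nat and D :: "real mat"
  assumes "\<And>j. degree (\<phi> j) = j"
    and "\<phi> 0 = 1"
    and "\<And>j. \<alpha> j \<noteq> 0"
    and "three_term_recurrence \<phi> \<alpha> \<beta> \<gamma>"
    and "n \<ge> 1"
  shows "is_differentiation_matrix \<phi> n D \<longleftrightarrow>
    D = transpose_mat
          (four_block_mat (0\<^sub>m 1 n) (0\<^sub>m 1 1)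
                          (Q_mat \<alpha> \<beta> \<gamma> n) (0\<^sub>m n 1))"
  unfolding transpose_four_block_Q_mat
  using assms(1,2) pderiv_eq_sum_Q_entry[of \<phi> \<alpha>, OF assms(2-4)]
  by (intro is_differentiation_matrix_iff) simp_all

end
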